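(* Let $\mathfrak{P}$ be an infinite set of primes having a density $\kappa\in(0,1]$ in the sense that $\sum_{p\le X,\,p\in\mathfrak{P}}\frac{\log p}{p}=\kappa\log X+O(1)$ for $X\ge2$. For $y\ge 2$ put $\mathfrak{P}(y)=\prod_{p<y,\,p\in\mathfrak{P}}p$. Let $N$ be large, $2\le z\le D\le\sqrt N$ and $Z\ge z$. Define, for positive integers $m$, $$\rho(m)=\frac{\mathbf{1}_{(m,\mathfrak{P}(z))=1}}{1+\#\{p'\in[z,Z]\cap\mathfrak{P}:\ p'\mid m\}}\in[0,1].$$ Then for any sequence of complex numbers $(u_n)_{1\le n\le N}$ we have $$\sum_{\substack{n\le N\\ (n,\mathfrak{P}(Z))=1}}u_n=\sum_{\substack{d\mid\mathfrak{P}(z)\\ d\le D}}\mu(d)\sum_{\substack{n\le N\\ n\equiv0\ (\mathrm{mod}\ d)}}u_n-\sum_{\substack{mp\le N\\ z\le p<Z,\ p\in\mathfrak{P}}}\rho(m)u_{mp}+\theta E,\qquad |\theta|\le1,$$ where $$E=\sqrt{N\sum_{n\le N}|u_n|^2}\left(\frac{1}{\sqrt z}+\exp\Bigl(\frac{-\log D}{\log z}\Bigr)(\log 3z)^{31}\right).$$ Moreover, if $|u_n|\le1$ for all $n$, the same holds with the first term $\sqrt{N\sum_n|u_n|^2}/\sqrt z$ of $E$ replaced by $N/z$.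
   Context: $\mu$ is the Möbius function; $p,p'$ denote primes. All sums over $n$ run over $1\le n\le N$. *)

theory Defs
  imports Complex_Main "HOL-Computational_Algebra.Squarefree"
begin

definition moebius_mu :: "nat \<Rightarrow> int" where
  "moebius_mu n = (if squarefree n then (-1) ^ card (prime_factors n) else 0)"

definition has_log_density :: "nat set \<Rightarrow> real \<Rightarrow> bool" where
  "has_log_density P \<kappa> \<longleftrightarrow>
     (\<exists>C. \<forall>X::real. 2 \<le> X \<longrightarrow>
        \<bar>(\<Sum>p | p \<in> P \<and> real p \<le> X. ln (real p) / real p) - \<kappa> * ln X\<bar> \<le> C)"

definition prime_prod :: "nat set \<Rightarrow> real \<Rightarrow> nat" where
  "prime_prod P y = (\<Prod>p | p \<in> P \<and> real p < y. p)"

(* The primes p' are counted on the closed interval [z, Z]. *)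
definition rho :: "nat set \<Rightarrow> real \<Rightarrow> real \<Rightarrow> nat \<Rightarrow> real" where
  "rho P z Z m =
     (if coprime m (prime_prod P z) then 1 else 0) /
     (1 + real (card {p' \<in> P. z \<le> real p' \<and> real p' \<le> Z \<and> p' dvd m}))"

lemma rho_range: "rho P z Z m \<in> {0..1}"
  by (simp add: rho_def)

end

theory Submission
  imports Defs "HOL-Analysis.Complex_Transcendental" "HOL-Analysis.Harmonic_Numbers"
begin

text \<open>
  The remainder is a sum of \<open>u n * (e n - c n)\<close>, where \<open>e n\<close> is the error of truncating the Legendre
  sieve at level \<open>D\<close> and \<open>c n\<close> measures how far the weights \<open>\<rho>(n/p)\<close> are from summing to 1 over
  the primes \<open>p\<close> in \<open>[z, Z)\<close> dividing a sifted \<open>n\<close>. Rankin's trick with exponent \<open>1 / log z\<close> gives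
  \<open>|e n| \<le> D powr (-1 / log z) * (1 + e) ^ \<omega>\<close> with \<open>\<omega>\<close> the number of sieving primes below \<open>z\<close>
  dividing \<open>n\<close>. As \<open>(1 + e)\<^sup>2 \<le> 14\<close>, the mean square of \<open>(1 + e) ^ \<omega>\<close> is at most the product of
  \<open>1 + 13 / p\<close>, and a dyadic Chebyshev bound for primes puts this below \<open>(log 3z) ^ 62\<close>. Finally
  \<open>0 \<le> c n \<le> 1\<close>, and \<open>c n\<close> vanishes unless \<open>n\<close> is divisible by \<open>p\<^sup>2\<close> for some \<open>p \<ge> z\<close>, or by
  both \<open>Z\<close> and a smaller prime of \<open>[z, Z)\<close> (the count in \<open>\<rho>\<close> includes \<open>p' = Z\<close>, the sum over \<open>p\<close>
  does not); this makes the sum of the \<open>c n\<close> at most \<open>N / z\<close>. Both errors are combined with \<open>u\<close> by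
  the Cauchy-Schwarz inequality.
\<close>

section \<open>Divisors of a product of distinct primes\<close>

lemma prod_primes_dvd_iff:
  fixes B :: "nat set"
  assumes "finite B" "\<And>p. p \<in> B \<Longrightarrow> prime p"
  shows "\<Prod>B dvd n \<longleftrightarrow> (\<forall>p\<in>B. p dvd n)"
  using assms
proof (induction B rule: finite_induct)
  case (insert p B)
  have "coprime p (\<Prod>B)"
    using insert by (intro prod_coprime_right) (metis primes_coprime insert_iff)
  then show ?case
    using insert by (auto intro: divides_mult dest: dvd_mult_left dvd_mult_right)
qed simp

lemma dvd_prod_primes_imp_prod:
  fixes A :: "nat set"
  assumes "finite A" "\<And>p. p \<in> A \<Longrightarrow> prime p" "d dvd \<Prod>A"
  shows "\<exists>B\<subseteq>A. d = \<Prod>B"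
  using assms
proof (induction A arbitrary: d rule: finite_induct)
  case (insert p A)
  have d: "d dvd p * \<Prod>A" using insert by simp
  show ?case
  proof (cases "p dvd d")
    case True
    then obtain e where e: "d = p * e" by auto
    have "p \<noteq> 0" using insert.prems(1)[of p] by auto
    then have "e dvd \<Prod>A" using d e by simp
    then obtain B where B: "B \<subseteq> A" "e = \<Prod>B" using insert.IH insert.prems by auto
    have "finite B" "p \<notin> B" using B insert by (auto intro: finite_subset)
    then have "d = \<Prod>(insert p B)" using e B by simp
    then show ?thesis using B by blast
  next
    case False
    then have "coprime d p"
      using insert.prems(1)[of p] prime_imp_coprime[of p d] by (simp add: coprime_commute)
    then have "d dvd \<Prod>A" using d by (simp add: coprime_dvd_mult_right_iff)
    then show ?thesis using insert.IH insert.prems by (meson insertI2 subset_insertI2)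
  qed
qed auto

lemma prime_factors_prod_primes:
  fixes B :: "nat set"
  assumes "finite B" "\<And>p. p \<in> B \<Longrightarrow> prime p"
  shows "prime_factors (\<Prod>B) = B"
proof -
  have "0 \<notin> B" using assms(2)[of 0] by auto
  then have "prime_factors (\<Prod>B) = (\<Union>p\<in>B. prime_factors p)"
    using prime_factors_prod[of B "\<lambda>p. p"] assms by simp
  also have "\<dots> = (\<Union>p\<in>B. {p})"
    using assms(2) by (intro SUP_cong refl) (simp add: prime_prime_factors)
  finally show ?thesis by simp
qed

lemma moebius_mu_prod_primes:
  fixes B :: "nat set"
  assumes "finite B" "\<And>p. p \<in> B \<Longrightarrow> prime p"
  shows "moebius_mu (\<Prod>B) = (-1) ^ card B"
proof -
  have "squarefree (\<Prod>B)"
    using assms(2) by (intro squarefree_prod_coprime) (auto intro: primes_coprime squarefree_prime)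
  then show ?thesis by (simp add: moebius_mu_def prime_factors_prod_primes[OF assms])
qed

text \<open>Unique factorisation: \<open>prime_factors\<close> inverts \<open>\<Prod>\<close> on
  sets of primes. Divisor sums thereby become sums over subsets, where products of the shape
  \<open>\<Prod>(f p + 1)\<close> can be expanded and refolded. The predicate \<open>Q\<close>
  carries the truncation \<open>d \<le> D\<close>.\<close>

lemma bij_betw_Pow_divisors_prod_primes:
  fixes A :: "nat set"
  assumes fin: "finite A" and pr: "\<And>p. p \<in> A \<Longrightarrow> prime p"
  shows "bij_betw \<Prod> {B \<in> Pow {p\<in>A. p dvd n}. Q (\<Prod>B)} {d. d dvd \<Prod>A \<and> Q d \<and> d dvd n}"
proof -
  let ?S = "{B \<in> Pow {p\<in>A. p dvd n}. Q (\<Prod>B)}" and ?T = "{d. d dvd \<Prod>A \<and> Q d \<and> d dvd n}"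
  have sub: "finite B" "prime_factors (\<Prod>B) = B" "\<Prod>B dvd n \<longleftrightarrow> (\<forall>p\<in>B. p dvd n)" if "B \<subseteq> A" for B
  proof -
    show B: "finite B" using that fin by (rule finite_subset)
    show "prime_factors (\<Prod>B) = B"
      by (rule prime_factors_prod_primes[OF B]) (use that pr in blast)
    show "\<Prod>B dvd n \<longleftrightarrow> (\<forall>p\<in>B. p dvd n)"
      by (rule prod_primes_dvd_iff[OF B]) (use that pr in blast)
  qed
  have "inj_on \<Prod> ?S"
    by (rule inj_on_inverseI[where g = prime_factors], rule sub) blast
  moreover have "\<Prod> ` ?S \<subseteq> ?T"
  proof (rule image_subsetI)
    fix B assume B: "B \<in> ?S"
    then have "B \<subseteq> A" by blast
    moreover have "\<Prod>B dvd \<Prod>A" using fin \<open>B \<subseteq> A\<close> by (rule prod_dvd_prod_subset)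
    ultimately show "\<Prod>B \<in> ?T" using B sub(3)[of B] by blast
  qed
  moreover have "?T \<subseteq> \<Prod> ` ?S"
  proof
    fix d assume d: "d \<in> ?T"
    then obtain B where "B \<subseteq> A" "d = \<Prod>B"
      using dvd_prod_primes_imp_prod[OF fin pr] by blast
    then show "d \<in> \<Prod> ` ?S" using d sub(3)[of B] by blast
  qed
  ultimately show ?thesis unfolding bij_betw_def by blast
qed

section \<open>Truncating the Legendre sieve\<close>

text \<open>Without truncation the Moebius sum is exactly the indicator of \<open>C = {}\<close>, so
  the error is the tail over subsets of \<open>C\<close> with product above \<open>D\<close>.
  Rankin's trick bounds that tail by a full sum over subsets, which is an Euler product with at most
  \<open>1 + exp 1\<close> per prime.\<close>

lemma truncated_moebius_error:
  fixes A :: "nat set" and z D :: real and n :: nat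
  assumes fin: "finite A" and pr: "\<And>p. p \<in> A \<Longrightarrow> prime p"
    and z: "1 < z" "\<And>p. p \<in> A \<Longrightarrow> real p < z" and D: "0 < D"
  defines "C \<equiv> {p\<in>A. p dvd n}"
  shows "\<bar>(if C = {} then 1 else 0) -
            (\<Sum>d | d dvd \<Prod>A \<and> real d \<le> D \<and> d dvd n. real_of_int (moebius_mu d))\<bar>
         \<le> exp (- ln D / ln z) * (1 + exp 1) ^ card C"
proof -
  have finC: "finite C" and prC: "\<And>p. p \<in> C \<Longrightarrow> prime p" using fin pr by (auto simp: C_def)
  have finB: "finite B" and prB: "\<And>p. p \<in> B \<Longrightarrow> prime p" if "B \<subseteq> C" for B
    using that finC prC by (auto intro: finite_subset)
  let ?lo = "{B \<in> Pow C. real (\<Prod>B) \<le> D}" and ?hi = "{B \<in> Pow C. \<not> real (\<Prod>B) \<le> D}"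
  have "(\<Sum>d | d dvd \<Prod>A \<and> real d \<le> D \<and> d dvd n. real_of_int (moebius_mu d))
        = (\<Sum>B\<in>?lo. real_of_int (moebius_mu (\<Prod>B)))"
    using sum.reindex_bij_betw[OF bij_betw_Pow_divisors_prod_primes[OF fin pr,
        where n = n and Q = "\<lambda>d. real d \<le> D"], of "\<lambda>d. real_of_int (moebius_mu d)"]
    by (simp add: C_def)
  also have "\<dots> = (\<Sum>B\<in>?lo. (-1) ^ card B)"
    using finB prB by (intro sum.cong refl) (subst moebius_mu_prod_primes, auto)
  finally have lo: "(\<Sum>d | d dvd \<Prod>A \<and> real d \<le> D \<and> d dvd n. real_of_int (moebius_mu d))
        = (\<Sum>B\<in>?lo. (-1) ^ card B)" .
  \<comment> \<open>Each factor of the product is 0, so only the empty product survives.\<close>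
  have "(\<Sum>B\<in>Pow C. (-1) ^ card B) = (\<Prod>p\<in>C. (-1) + (1::real))"
    by (subst prod_add[OF finC]) simp
  also have "\<dots> = (if C = {} then 1 else 0)" using finC by (simp add: card_gt_0_iff)
  finally have "(if C = {} then 1 else 0) = (\<Sum>B\<in>Pow C. (-1::real) ^ card B)" by simp
  also have "\<dots> = (\<Sum>B\<in>?lo. (-1) ^ card B) + (\<Sum>B\<in>?hi. (-1) ^ card B)"
    using finC by (subst sum.union_disjoint [symmetric]) (auto intro!: sum.cong)
  finally have "\<bar>(if C = {} then 1 else 0) -
            (\<Sum>d | d dvd \<Prod>A \<and> real d \<le> D \<and> d dvd n. real_of_int (moebius_mu d))\<bar>
         = \<bar>\<Sum>B\<in>?hi. (-1::real) ^ card B\<bar>" using lo by simp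
  also have "\<dots> \<le> (\<Sum>B\<in>?hi. 1)"
    by (rule order_trans[OF sum_abs]) (simp add: power_abs)
  \<comment> \<open>The summand on the right is \<open>(\<Prod>B / D) powr (1 / ln z)\<close>, which
    is at least 1 because \<open>\<Prod>B > D\<close>.\<close>
  also have "\<dots> \<le> (\<Sum>B\<in>?hi. exp (- ln D / ln z) * (\<Prod>p\<in>B. exp (ln (real p) / ln z)))"
  proof (rule sum_mono)
    fix B assume B: "B \<in> ?hi"
    then have "finite B" "\<And>p. p \<in> B \<Longrightarrow> 0 < p"
      using finB prB by (auto simp: prime_gt_0_nat)
    then have "ln (real (\<Prod>B)) = (\<Sum>p\<in>B. ln (real p))" by (simp add: ln_prod)
    moreover have "ln D \<le> ln (real (\<Prod>B))" using B D by (subst ln_le_cancel_iff) auto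
    ultimately have "0 \<le> (- ln D + (\<Sum>p\<in>B. ln (real p))) / ln z"
      using z by (intro divide_nonneg_pos) auto
    then have "1 \<le> exp ((- ln D + (\<Sum>p\<in>B. ln (real p))) / ln z)" by simp
    also have "\<dots> = exp (- ln D / ln z) * (\<Prod>p\<in>B. exp (ln (real p) / ln z))"
      using \<open>finite B\<close> by (simp only: add_divide_distrib exp_add sum_divide_distrib exp_sum)
    finally show "1 \<le> exp (- ln D / ln z) * (\<Prod>p\<in>B. exp (ln (real p) / ln z))" .
  qed
  also have "\<dots> \<le> (\<Sum>B\<in>Pow C. exp (- ln D / ln z) * (\<Prod>p\<in>B. exp (ln (real p) / ln z)))"
    using finC by (intro sum_mono2) (auto intro!: mult_nonneg_nonneg prod_nonneg)
  also have "\<dots> = exp (- ln D / ln z) * (\<Prod>p\<in>C. exp (ln (real p) / ln z) + 1)"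
    by (subst prod_add[OF finC]) (simp add: sum_distrib_left)
  also have "\<dots> \<le> exp (- ln D / ln z) * (\<Prod>p\<in>C. 1 + exp 1)"
  \<comment> \<open>The exponent \<open>1 / ln z\<close> is chosen so that
    \<open>p powr (1 / ln z) \<le> z powr (1 / ln z) = e\<close> for every
    \<open>p < z\<close>.\<close>
  proof (intro mult_left_mono prod_mono conjI)
    fix p assume p: "p \<in> C"
    have "ln (real p) \<le> ln z"
      using p prC[OF p] z(2)[of p] by (subst ln_le_cancel_iff) (auto simp: C_def prime_gt_0_nat)
    then show "exp (ln (real p) / ln z) + 1 \<le> 1 + exp 1" using z by simp
  qed (auto simp: add_nonneg_nonneg)
  finally show ?thesis by simp
qed

section \<open>Mean values over multiples\<close>

lemma card_multiples_le: "real (card {n\<in>{1..N}. d dvd n}) \<le> real N / real d"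
\<comment> \<open>For \<open>d = 0\<close> both sides vanish: no \<open>n \<ge> 1\<close> is a
  multiple of 0, and division by 0 gives 0.\<close>
proof (cases "d = 0")
  case False
  have "{n\<in>{1..N}. d dvd n} \<subseteq> (\<lambda>k. d * k) ` {1..N div d}"
    using False by (auto elim!: dvdE simp: less_eq_div_iff_mult_less_eq mult.commute Suc_le_eq)
  then have "card {n\<in>{1..N}. d dvd n} \<le> card ((\<lambda>k. d * k) ` {1..N div d})"
    by (intro card_mono) auto
  also have "\<dots> \<le> N div d" using card_image_le[of "{1..N div d}"] by simp
  finally have "real (card {n\<in>{1..N}. d dvd n}) \<le> real (N div d)" by simp
  also have "\<dots> \<le> real N / real d" by (rule of_nat_div_le_of_nat)
  finally show ?thesis .
next
  case True
  then have "{n\<in>{1..N}. d dvd n} = {}" by auto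
  then show ?thesis using True by simp
qed

text \<open>Expanding the power over sets \<open>B\<close> of primes dividing \<open>n\<close> and
  exchanging the sums leaves a count of multiples of \<open>\<Prod>B\<close>, at most
  \<open>N / \<Prod>B\<close>. The resulting sum refolds into the product of
  \<open>1 + b / p\<close>, and \<open>1 + x \<le> exp x\<close> finishes.\<close>

lemma sum_power_card_prime_divisors_le:
  fixes A :: "nat set" and b :: real
  assumes fin: "finite A" and pr: "\<And>p. p \<in> A \<Longrightarrow> prime p" and b: "0 \<le> b"
  shows "(\<Sum>n\<in>{1..N}. (1 + b) ^ card {p\<in>A. p dvd n}) \<le> real N * exp (b * (\<Sum>p\<in>A. 1 / real p))"
proof -
  have exp_card: "(1 + b) ^ card {p\<in>A. p dvd n} = (\<Sum>B\<in>Pow A. if \<Prod>B dvd n then b ^ card B else 0)" for n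
  proof -
    have finC: "finite {p\<in>A. p dvd n}" using fin by simp
    have "(1 + b) ^ card {p\<in>A. p dvd n} = (\<Prod>p\<in>{p\<in>A. p dvd n}. b + 1)" by (simp add: add.commute)
    also have "\<dots> = (\<Sum>B\<in>Pow {p\<in>A. p dvd n}. b ^ card B)"
      by (subst prod_add[OF finC]) simp
    also have "\<dots> = (\<Sum>B\<in>{B \<in> Pow A. \<Prod>B dvd n}. b ^ card B)"
    proof (rule sum.cong)
      have "\<Prod>B dvd n \<longleftrightarrow> (\<forall>p\<in>B. p dvd n)" if "B \<subseteq> A" for B
        using that fin pr by (intro prod_primes_dvd_iff) (auto intro: finite_subset)
      then show "Pow {p\<in>A. p dvd n} = {B \<in> Pow A. \<Prod>B dvd n}" by blast
    qed simp
    also have "\<dots> = (\<Sum>B\<in>Pow A. if \<Prod>B dvd n then b ^ card B else 0)"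
      using fin by (subst sum.inter_filter) auto
    finally show ?thesis .
  qed
  have "(\<Sum>n\<in>{1..N}. (1 + b) ^ card {p\<in>A. p dvd n})
      = (\<Sum>B\<in>Pow A. \<Sum>n\<in>{1..N}. if \<Prod>B dvd n then b ^ card B else 0)"
    unfolding exp_card by (rule sum.swap)
  also have "\<dots> = (\<Sum>B\<in>Pow A. b ^ card B * real (card {n\<in>{1..N}. \<Prod>B dvd n}))"
    by (intro sum.cong refl) (subst sum.inter_filter [symmetric], auto)
  also have "\<dots> \<le> (\<Sum>B\<in>Pow A. b ^ card B * (real N / real (\<Prod>B)))"
    using b by (intro sum_mono mult_left_mono card_multiples_le) auto
  also have "\<dots> = real N * (\<Sum>B\<in>Pow A. \<Prod>p\<in>B. b / real p)"
    by (simp add: sum_distrib_left prod_dividef mult.commute)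
  also have "\<dots> = real N * (\<Prod>p\<in>A. b / real p + 1)"
    by (subst prod_add[OF fin]) simp
  also have "\<dots> \<le> real N * (\<Prod>p\<in>A. exp (b / real p))"
    using b by (intro mult_left_mono prod_mono) (auto intro: add_nonneg_nonneg simp: add.commute[of _ 1])
  also have "\<dots> = real N * exp (b * (\<Sum>p\<in>A. 1 / real p))"
    using fin by (simp add: exp_sum sum_distrib_left)
  finally show ?thesis .
qed

section \<open>Chebyshev-type bounds for sums over primes\<close>

text \<open>Every prime in \<open>(n, 2n]\<close> divides the central binomial coefficient, which is at most \<open>4^n\<close>.\<close>

lemma power_card_primes_le:
  assumes "0 < n"
  shows "n ^ card {p. prime p \<and> n < p \<and> p \<le> 2 * n} \<le> (4::nat) ^ n"
proof -
  let ?B = "{p. prime p \<and> n < p \<and> p \<le> 2 * n}"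
  have fin: "finite ?B" by (rule finite_subset[of _ "{..2*n}"]) auto
  have "p dvd (2 * n) choose n" if p: "p \<in> ?B" for p
  proof -
    have "p dvd fact (2 * n)" using p by (simp add: prime_dvd_fact_iff)
    also have "(fact (2 * n) :: nat) = fact n * fact n * ((2 * n) choose n)"
      using binomial_fact_lemma[of n "2 * n"] by (simp add: mult_2)
    finally have "p dvd fact n * fact n * ((2 * n) choose n)" .
    moreover have "\<not> p dvd fact n" using p by (simp add: prime_dvd_fact_iff)
    ultimately show ?thesis using p by (auto simp: prime_dvd_mult_iff)
  qed
  then have "\<Prod>?B dvd (2 * n) choose n" using fin by (subst prod_primes_dvd_iff) auto
  then have "\<Prod>?B \<le> (2 * n) choose n" by (intro dvd_imp_le) auto
  also have "\<dots> \<le> 2 ^ (2 * n)" by (rule binomial_le_pow2)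
  also have "\<dots> = 4 ^ n" by (simp add: power_mult)
  finally have "\<Prod>?B \<le> 4 ^ n" .
  moreover have "(\<Prod>p\<in>?B. n) \<le> \<Prod>?B" by (intro prod_mono) auto
  ultimately show ?thesis by simp
qed

text \<open>Taking logarithms to base 2 in the binomial bound with \<open>n = 2 ^ k\<close> leaves
  at most \<open>2 * 2 ^ k / k\<close> primes in the block, each with reciprocal at most
  \<open>1 / 2 ^ k\<close>.\<close>

lemma sum_inverse_primes_dyadic_le:
  assumes "0 < k"
  shows "(\<Sum>p | prime p \<and> 2 ^ k < p \<and> p \<le> 2 ^ Suc k. 1 / real p) \<le> 2 / real k"
proof -
  let ?B = "{p::nat. prime p \<and> 2 ^ k < p \<and> p \<le> 2 ^ Suc k}"
  have "(2 ^ k) ^ card ?B \<le> (4::nat) ^ (2 ^ k)"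
    using power_card_primes_le[of "2 ^ k"] by simp
  then have "(2::nat) ^ (k * card ?B) \<le> 2 ^ (2 * 2 ^ k)"
    by (simp add: power_mult)
  then have "k * card ?B \<le> 2 * 2 ^ k" by (subst (asm) power_increasing_iff) auto
  then have "real (k * card ?B) \<le> real (2 * 2 ^ k)" by (simp only: of_nat_le_iff)
  then have "real k * real (card ?B) \<le> 2 * 2 ^ k" by simp
  then have card: "real (card ?B) / 2 ^ k \<le> 2 / real k"
    using assms by (simp add: field_simps)
  have "(\<Sum>p\<in>?B. 1 / real p) \<le> (\<Sum>p\<in>?B. 1 / 2 ^ k)"
  proof (rule sum_mono)
    fix p assume "p \<in> ?B"
    then have "real (2 ^ k) \<le> real p" by (simp only: of_nat_le_iff) simp
    then show "1 / real p \<le> 1 / 2 ^ k" by (simp add: frac_le)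
  qed
  also have "\<dots> \<le> 2 / real k" using card by simp
  finally show ?thesis .
qed

text \<open>The exponent 62 is twice the 31 of the final error term, and 13 comes from
  \<open>(1 + e)\<^sup>2 \<le> 14\<close>. The base \<open>(2 * k + 5) / 3\<close> equals
  \<open>2 / 3 * (m + 3 / 2)\<close> with \<open>m = k + 1\<close>, which stays below
  \<open>ln (3 * 2 ^ m)\<close>. The induction adds one dyadic block at a time and compares its
  contribution with the logarithm of the ratio of consecutive bases.\<close>

lemma exp_sum_inverse_primes_dyadic_le:
  "exp (13 * (\<Sum>p | prime p \<and> p \<le> 2 ^ Suc (Suc k). 1 / real p)) \<le> ((2 * real k + 5) / 3) ^ 62"
proof (induction k)
  case 0
  have "{p::nat. prime p \<and> p \<le> 4} = {2, 3}"
  proof (intro equalityI subsetI)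
    fix p :: nat assume p: "p \<in> {p. prime p \<and> p \<le> 4}"
    moreover have "\<not> prime (4::nat)" using prime_product[of 2 "2::nat"] by auto
    ultimately have "p \<noteq> 4" "p \<ge> 2" "p \<le> 4" by (auto dest: prime_ge_2_nat)
    then show "p \<in> {2, 3}" by auto
  qed (auto simp: two_is_prime_nat)
  then have "13 * (\<Sum>p | prime p \<and> p \<le> 2 ^ Suc (Suc 0). 1 / real p) \<le> 62 * (2 / 5)" by simp
  \<comment> \<open>A lower bound for a logarithm is obtained from \<open>ln x \<le> x - 1\<close>
    at the reciprocal, here \<open>3 / 5\<close>; the inductive step uses the same device.\<close>
  also have "\<dots> \<le> 62 * ln (5 / 3 :: real)"
    using ln_le_minus_one[of "3 / 5"] by (simp add: ln_div)
  finally have "exp (13 * (\<Sum>p | prime p \<and> p \<le> 2 ^ Suc (Suc 0). 1 / real p)) \<le> exp (62 * ln (5 / 3))"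
    by simp
  also have "\<dots> = (5 / 3) ^ 62" using exp_of_nat_mult[of 62 "ln (5/3::real)"] by simp
  finally show ?case by simp
next
  case (Suc k)
  let ?S = "\<lambda>k. \<Sum>p | prime p \<and> p \<le> 2 ^ Suc (Suc k). 1 / real p"
  let ?B = "{p::nat. prime p \<and> 2 ^ Suc (Suc k) < p \<and> p \<le> 2 ^ Suc (Suc (Suc k))}"
  have "{p::nat. prime p \<and> p \<le> 2 ^ Suc (Suc (Suc k))} = {p. prime p \<and> p \<le> 2 ^ Suc (Suc k)} \<union> ?B"
    by auto
  moreover have "finite {p::nat. prime p \<and> p \<le> m}" for m by (rule finite_subset[of _ "{..m}"]) auto
  moreover have "finite ?B" by (rule finite_subset[of _ "{..2 ^ Suc (Suc (Suc k))}"]) auto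
  ultimately have "?S (Suc k) = ?S k + (\<Sum>p\<in>?B. 1 / real p)"
    by (simp only:) (subst sum.union_disjoint, auto)
  also have "\<dots> \<le> ?S k + 2 / (real k + 2)"
    using sum_inverse_primes_dyadic_le[of "Suc (Suc k)"] by (simp add: add.commute)
  finally have "13 * ?S (Suc k) \<le> 13 * ?S k + 26 / (real k + 2)" by simp
  also have "26 / (real k + 2) \<le> 62 * (2 / (2 * real k + 7))" by (simp add: field_simps)
  also have "2 / (2 * real k + 7) \<le> ln ((2 * real k + 7) / (2 * real k + 5))"
  proof -
    have "ln ((2 * real k + 5) / (2 * real k + 7)) \<le> - (2 / (2 * real k + 7))"
      using ln_le_minus_one[of "(2 * real k + 5) / (2 * real k + 7)"] by (simp add: field_simps)
    then show ?thesis by (simp add: ln_div)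
  qed
  finally have "exp (13 * ?S (Suc k)) \<le> exp (13 * ?S k + 62 * ln ((2 * real k + 7) / (2 * real k + 5)))"
    by simp
  also have "\<dots> = exp (13 * ?S k) * ((2 * real k + 7) / (2 * real k + 5)) ^ 62"
    using exp_of_nat_mult[of 62 "ln ((2 * real k + 7) / (2 * real k + 5))"] by (simp add: exp_add)
  also have "\<dots> \<le> ((2 * real k + 5) / 3) ^ 62 * ((2 * real k + 7) / (2 * real k + 5)) ^ 62"
    using Suc.IH by (intro mult_right_mono) auto
  also have "\<dots> = ((2 * real k + 5) / 3 * ((2 * real k + 7) / (2 * real k + 5))) ^ 62"
    by (simp only: power_mult_distrib)
  also have "(2 * real k + 5) / 3 * ((2 * real k + 7) / (2 * real k + 5)) = (2 * real (Suc k) + 5) / 3"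
    by (simp add: field_simps)
  finally show ?case .
qed

lemma exp_sum_inverse_primes_le:
  fixes z :: real
  assumes z: "2 \<le> z" and pr: "\<And>p. p \<in> A \<Longrightarrow> prime p \<and> real p < z"
  shows "exp (13 * (\<Sum>p\<in>A. 1 / real p)) \<le> ln (3 * z) ^ 62"
proof -
  \<comment> \<open>\<open>2 ^ m \<le> z < 2 ^ Suc m\<close>: the upper bound places all of
    \<open>A\<close> within the dyadic range for \<open>k = m - 1\<close>, and the lower bound
    returns from \<open>m\<close> to \<open>z\<close>.\<close>
  define m where "m = nat \<lfloor>log 2 z\<rfloor>"
  have "1 \<le> log 2 z" using z by simp
  then have m: "1 \<le> m" "real m \<le> log 2 z" "log 2 z < real m + 1" unfolding m_def by linarith+
  then obtain k where k: "m = Suc k" by (cases m) auto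
  have lo: "2 ^ m \<le> z" using m z by (subst (asm) le_log_iff) (auto simp: powr_realpow)
  have hi: "z < 2 ^ Suc m" using m z by (subst (asm) log_less_iff) (auto simp: powr_realpow powr_add)
  have "p \<le> 2 ^ Suc (Suc k)" if "p \<in> A" for p
  proof -
    have "real p \<le> real (2 ^ Suc (Suc k))" using pr[OF that] hi k by simp
    then show ?thesis by (simp only: of_nat_le_iff)
  qed
  then have "(\<Sum>p\<in>A. 1 / real p) \<le> (\<Sum>p | prime p \<and> p \<le> 2 ^ Suc (Suc k). 1 / real p)"
    using pr by (intro sum_mono2) (auto intro: finite_subset[of _ "{..2 ^ Suc (Suc k)}"])
  then have "exp (13 * (\<Sum>p\<in>A. 1 / real p)) \<le> ((2 * real k + 5) / 3) ^ 62"
    by (intro order_trans[OF _ exp_sum_inverse_primes_dyadic_le[of k]]) simp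
  also have "\<dots> \<le> ln (3 * z) ^ 62"
  proof (rule power_mono)
    \<comment> \<open>Comparing \<open>2 ^ 3\<close> with \<open>3 ^ 2\<close> gives
      \<open>ln 3 \<ge> 3 / 2 * ln 2\<close>; the factor 3 in \<open>ln (3 * z)\<close> thus absorbs
      the offset \<open>3 / 2\<close> added to \<open>m\<close>.\<close>
    have "ln (8::real) \<le> ln 9" by simp
    moreover have "ln (8::real) = 3 * ln 2" "ln (9::real) = 2 * ln 3"
      using ln_realpow[of 2 3] ln_realpow[of 3 2] by simp_all
    ultimately have ln3: "3 / 2 * ln 2 \<le> ln (3::real)" by simp
    have "(2 * real k + 5) / 3 = 2 / 3 * (real m + 3 / 2)" using k by simp
    also have "\<dots> \<le> ln 2 * (real m + 3 / 2)"
      using ln2_ge_two_thirds by (intro mult_right_mono) auto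
    also have "\<dots> \<le> ln 3 + real m * ln 2" using ln3 by (simp add: algebra_simps)
    also have "\<dots> = ln (3 * 2 ^ m)" by (simp add: ln_mult ln_realpow)
    also have "\<dots> \<le> ln (3 * z)" using lo z by (subst ln_le_cancel_iff) auto
    finally show "(2 * real k + 5) / 3 \<le> ln (3 * z)" .
  qed simp
  finally show ?thesis .
qed

section \<open>Mean square of the truncation error\<close>

lemma finite_nat_real_less: "finite {p::nat. p \<in> P \<and> real p < y}"
  by (rule finite_subset[of _ "{..nat \<lceil>y\<rceil>}"]) (auto, linarith)

lemma sum_truncated_moebius_error_squared_le:
  fixes A :: "nat set" and z D :: real
  assumes pr: "\<And>p. p \<in> A \<Longrightarrow> prime p" and z: "2 \<le> z" "\<And>p. p \<in> A \<Longrightarrow> real p < z" and D: "0 < D"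
  shows "(\<Sum>n\<in>{1..N}. ((if {p\<in>A. p dvd n} = {} then 1 else 0) -
            (\<Sum>d | d dvd \<Prod>A \<and> real d \<le> D \<and> d dvd n. real_of_int (moebius_mu d)))\<^sup>2)
         \<le> real N * (exp (- ln D / ln z) * ln (3 * z) ^ 31)\<^sup>2"
proof -
  let ?x = "exp (- ln D / ln z)"
  have fin: "finite A"
    using z(2) by (intro finite_subset[OF _ finite_nat_real_less[of A z]]) auto
  \<comment> \<open>From \<open>e < 2.72\<close> and \<open>3.72\<^sup>2 = 13.8384\<close>; the mean
    value bound can then be applied with \<open>b = 13\<close>.\<close>
  have "(1 + exp 1)\<^sup>2 \<le> (372 / 100 :: real)\<^sup>2"
    using e_less_272 by (intro power_mono) auto
  also have "\<dots> \<le> 1 + 13" by (simp add: power2_eq_square)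
  finally have e: "(1 + exp 1)\<^sup>2 \<le> 1 + (13::real)" .
  have "(\<Sum>n\<in>{1..N}. ((if {p\<in>A. p dvd n} = {} then 1 else 0) -
            (\<Sum>d | d dvd \<Prod>A \<and> real d \<le> D \<and> d dvd n. real_of_int (moebius_mu d)))\<^sup>2)
        \<le> (\<Sum>n\<in>{1..N}. ?x\<^sup>2 * (1 + 13) ^ card {p\<in>A. p dvd n})"
  proof (rule sum_mono)
    fix n
    let ?c = "card {p\<in>A. p dvd n}"
    have "((if {p\<in>A. p dvd n} = {} then 1 else 0) -
            (\<Sum>d | d dvd \<Prod>A \<and> real d \<le> D \<and> d dvd n. real_of_int (moebius_mu d)))\<^sup>2
          \<le> (?x * (1 + exp 1) ^ ?c)\<^sup>2"
      using truncated_moebius_error[OF fin pr _ z(2) D, of n] z(1)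
      by (intro power2_le_iff_abs_le[THEN iffD2]) auto
    also have "\<dots> = ?x\<^sup>2 * ((1 + exp 1)\<^sup>2) ^ ?c"
      by (simp only: power_mult_distrib power_mult [symmetric] mult.commute)
    also have "\<dots> \<le> ?x\<^sup>2 * (1 + 13) ^ ?c"
      using e by (intro mult_left_mono power_mono) auto
    finally show "((if {p\<in>A. p dvd n} = {} then 1 else 0) -
            (\<Sum>d | d dvd \<Prod>A \<and> real d \<le> D \<and> d dvd n. real_of_int (moebius_mu d)))\<^sup>2
          \<le> ?x\<^sup>2 * (1 + 13) ^ ?c" .
  qed
  also have "\<dots> = ?x\<^sup>2 * (\<Sum>n\<in>{1..N}. (1 + 13) ^ card {p\<in>A. p dvd n})"
    by (simp only: sum_distrib_left)
  also have "\<dots> \<le> ?x\<^sup>2 * (real N * exp (13 * (\<Sum>p\<in>A. 1 / real p)))"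
    by (intro mult_left_mono sum_power_card_prime_divisors_le fin pr) auto
  also have "\<dots> \<le> ?x\<^sup>2 * (real N * ln (3 * z) ^ 62)"
    using exp_sum_inverse_primes_le[OF z(1), of A] pr z(2) by (intro mult_left_mono) auto
  also have "\<dots> = real N * (?x * ln (3 * z) ^ 31)\<^sup>2"
    by (simp add: power_mult_distrib flip: power_mult)
  finally show ?thesis .
qed

section \<open>The defect of the weights\<close>

lemma coprime_prime_prod_iff:
  assumes "\<And>p. p \<in> P \<Longrightarrow> prime p"
  shows "coprime n (prime_prod P y) \<longleftrightarrow> (\<forall>p\<in>P. real p < y \<longrightarrow> \<not> p dvd n)"
proof
  assume cop: "coprime n (prime_prod P y)"
  show "\<forall>p\<in>P. real p < y \<longrightarrow> \<not> p dvd n"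
  proof (intro ballI impI notI)
    fix p assume p: "p \<in> P" "real p < y" "p dvd n"
    then have "p dvd prime_prod P y"
      unfolding prime_prod_def by (intro dvd_prodI finite_nat_real_less) auto
    then have "is_unit p" using cop p(3) coprime_common_divisor by blast
    then show False using assms[OF p(1)] by simp
  qed
next
  assume "\<forall>p\<in>P. real p < y \<longrightarrow> \<not> p dvd n"
  then show "coprime n (prime_prod P y)"
    unfolding prime_prod_def using assms prime_imp_coprime
    by (intro prod_coprime_right) (auto simp: coprime_commute)
qed

text \<open>The error in a Ramare-type identity: for \<open>n\<close> that survives the sieve up to
  \<open>z\<close> but not the one up to \<open>Z\<close>, the weights \<open>rho\<close> of the
  cofactors \<open>n div p\<close> should sum to 1.\<close>

definition weight_defect :: "nat set \<Rightarrow> real \<Rightarrow> real \<Rightarrow> nat \<Rightarrow> real" where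
  "weight_defect P z Z n =
     (if coprime n (prime_prod P z) \<and> (\<exists>p\<in>P. z \<le> real p \<and> real p < Z \<and> p dvd n) then 1 else 0)
     - (\<Sum>p | p \<in> P \<and> z \<le> real p \<and> real p < Z \<and> p dvd n. rho P z Z (n div p))"

text \<open>Let \<open>w\<close> count the primes of \<open>P\<close> in the closed interval
  \<open>[z, Z]\<close> that divide \<open>n\<close>. In the nontrivial case a prime
  \<open>p\<close> of \<open>G\<close> has weight \<open>1 / w\<close> if it divides
  \<open>n\<close> exactly once and \<open>1 / (1 + w)\<close> otherwise. As
  \<open>card G \<le> w\<close>, the weights sum to at most 1, and equality fails only through
  square divisors or through \<open>Z\<close> being a prime counted in \<open>w\<close> but not in
  \<open>G\<close>.\<close>

lemma weight_defect_bounds: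
  fixes z Z :: real
  assumes pr: "\<And>p. p \<in> P \<Longrightarrow> prime p" and n: "0 < n"
  defines "G \<equiv> {p. p \<in> P \<and> z \<le> real p \<and> real p < Z \<and> p dvd n}"
  shows "0 \<le> weight_defect P z Z n" "weight_defect P z Z n \<le> 1"
    and "weight_defect P z Z n \<le> (\<Sum>p\<in>G. if p\<^sup>2 dvd n then 1 / 2 else 0)
           + (if G \<noteq> {} \<and> (\<exists>q\<in>P. real q = Z \<and> q dvd n) then 1 / 2 else 0)"
proof -
  let ?c = "weight_defect P z Z n"
  let ?R = "(\<Sum>p\<in>G. if p\<^sup>2 dvd n then 1 / 2 else 0)
           + (if G \<noteq> {} \<and> (\<exists>q\<in>P. real q = Z \<and> q dvd n) then 1 / 2 else (0::real))"
  have R: "0 \<le> ?R" by (intro add_nonneg_nonneg sum_nonneg) auto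
  have c: "?c = (if coprime n (prime_prod P z) \<and> G \<noteq> {} then 1 else 0) - (\<Sum>p\<in>G. rho P z Z (n div p))"
    by (auto simp: weight_defect_def G_def)
  have finG: "finite G" by (rule finite_subset[of _ "{..n}"]) (use n in \<open>auto simp: G_def dest: dvd_imp_le\<close>)
  \<comment> \<open>Since \<open>p \<ge> z\<close>, removing a factor \<open>p\<close> does not
    affect divisibility by the primes below \<open>z\<close>.\<close>
  have cop: "coprime (n div p) (prime_prod P z) \<longleftrightarrow> coprime n (prime_prod P z)" if "p \<in> G" for p
  proof -
    have "\<not> q dvd p" if "q \<in> P" "real q < z" for q
      using that \<open>p \<in> G\<close> primes_dvd_imp_eq[of q p] pr by (auto simp: G_def)
    then have "coprime p (prime_prod P z)" using pr by (subst coprime_prime_prod_iff) auto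
    moreover have "n = p * (n div p)" using that by (simp add: G_def)
    ultimately show ?thesis by (metis coprime_mult_left_iff)
  qed
  have "0 \<le> ?c \<and> ?c \<le> 1 \<and> ?c \<le> ?R"
  proof (cases "coprime n (prime_prod P z) \<and> G \<noteq> {}")
    case False
    have "(\<Sum>p\<in>G. rho P z Z (n div p)) = 0"
      using False cop by (intro sum.neutral) (auto simp: rho_def)
    then have "?c = 0" using False c by auto
    then show ?thesis using R by simp
  next
    case True
    define H where "H = {p' \<in> P. z \<le> real p' \<and> real p' \<le> Z \<and> p' dvd n}"
    define w where "w = real (card H)"
    have finH: "finite H" by (rule finite_subset[of _ "{..n}"]) (use n in \<open>auto simp: H_def dest: dvd_imp_le\<close>)
    have GH: "G \<subseteq> H" by (auto simp: G_def H_def)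
    then have "0 < card G" "card G \<le> card H"
      using True finG finH by (auto simp: card_gt_0_iff intro: card_mono)
    then have w: "1 \<le> w" "real (card G) \<le> w" by (auto simp: w_def)
    have rho_eq: "rho P z Z (n div p) = (if p\<^sup>2 dvd n then 1 / (1 + w) else 1 / w)" if p: "p \<in> G" for p
    proof -
      let ?H' = "{p' \<in> P. z \<le> real p' \<and> real p' \<le> Z \<and> p' dvd n div p}"
      have n_eq: "n = p * (n div p)" using p by (simp add: G_def)
      have pp: "prime p" using p pr by (auto simp: G_def)
      have sq: "p\<^sup>2 dvd n \<longleftrightarrow> p dvd n div p"
        using pp by (subst n_eq) (simp add: power2_eq_square prime_gt_0_nat)
      have dvd: "q dvd n \<longleftrightarrow> q dvd n div p" if "q \<in> P" "q \<noteq> p" for q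
        using that pp pr[of q] primes_dvd_imp_eq[of q p] by (subst n_eq) (auto simp: prime_dvd_mult_iff)
      have "1 + real (card ?H') = (if p\<^sup>2 dvd n then 1 + w else w)"
      proof (cases "p\<^sup>2 dvd n")
        case True
        then have "?H' = H" using dvd sq p by (auto simp: H_def G_def)
        then show ?thesis using True by (simp add: w_def)
      next
        case False
        then have "?H' = H - {p}" using dvd sq p by (auto simp: H_def G_def)
        moreover have "p \<in> H" using p GH by auto
        ultimately show ?thesis using False finH w by (simp add: w_def of_nat_diff)
      qed
      then show ?thesis using True cop[OF p] by (simp add: rho_def)
    qed
    have c1: "?c = 1 - (\<Sum>p\<in>G. rho P z Z (n div p))" using True c by simp
    have "(\<Sum>p\<in>G. rho P z Z (n div p)) \<le> (\<Sum>p\<in>G. 1 / w)"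
      using w by (intro sum_mono) (auto simp: rho_eq field_simps)
    also have "\<dots> \<le> 1" using w by simp
    finally have "0 \<le> ?c" using c1 by simp
    moreover have "?c \<le> 1" using c1 rho_range by (simp add: sum_nonneg)
    moreover have "?c \<le> ?R"
    proof -
      have "(\<Sum>p\<in>G. 1 / w - (if p\<^sup>2 dvd n then 1 / 2 else 0)) \<le> (\<Sum>p\<in>G. rho P z Z (n div p))"
      proof (rule sum_mono)
        fix p assume p: "p \<in> G"
        \<comment> \<open>A square divisor costs this difference, which is largest at
          \<open>w = 1\<close>.\<close>
        have "1 / w - 1 / (1 + w) = 1 / (w * (1 + w))" using w by (simp add: field_simps)
        also have "\<dots> \<le> 1 / 2" using w mult_mono[of 1 w 2 "1 + w"] by (intro frac_le) auto
        finally show "1 / w - (if p\<^sup>2 dvd n then 1 / 2 else 0) \<le> rho P z Z (n div p)"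
          using rho_eq[OF p] by auto
      qed
      then have "?c \<le> (\<Sum>p\<in>G. if p\<^sup>2 dvd n then 1 / 2 else 0) + (1 - card G / w)"
        using c1 by (simp add: sum_subtractf)
      \<comment> \<open>If \<open>Z\<close> is such a prime then
        \<open>w = card G + 1 \<ge> 2\<close>, and the loss is \<open>1 / w\<close>.\<close>
      moreover have "1 - card G / w \<le> (if G \<noteq> {} \<and> (\<exists>q\<in>P. real q = Z \<and> q dvd n) then 1 / 2 else 0)"
      proof (cases "\<exists>q\<in>P. real q = Z \<and> q dvd n")
        case q: True
        then obtain q where q': "q \<in> P" "real q = Z" "q dvd n" by auto
        have "z \<le> Z" using True by (auto simp: G_def)
        then have "H = insert q G" "q \<notin> G" using q' by (auto simp: H_def G_def)
        then have "w = card G + 1" using finG by (simp add: w_def)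
        then show ?thesis using True q \<open>0 < card G\<close> by (simp add: field_simps)
      next
        case False
        then have "H = G" by (force simp: H_def G_def)
        then show ?thesis using False w by (simp add: w_def)
      qed
      ultimately show ?thesis by linarith
    qed
    ultimately show ?thesis by blast
  qed
  then show "0 \<le> ?c" "?c \<le> 1" "?c \<le> ?R" by blast+
qed

text \<open>Telescoping with half-integers: \<open>1 / k\<^sup>2\<close> is at most
  \<open>1 / (k - 1/2) - 1 / (k + 1/2)\<close>. The cruder bound \<open>1 / (a - 1)\<close> would be
  too weak to give the constant 1 in \<open>N / z\<close> below.\<close>

lemma sum_inverse_squares_le:
  assumes "1 \<le> a"
  shows "(\<Sum>k=a..N. 1 / (real k)\<^sup>2) \<le> 2 / (2 * real a - 1)"
proof (cases "a \<le> N")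
  case True
  have "(\<Sum>k=a..N. 1 / (real k)\<^sup>2) \<le> (\<Sum>k=a..N. (- 2 / (2 * real (Suc k) - 1)) - (- 2 / (2 * real k - 1)))"
  proof (rule sum_mono)
    fix k assume "k \<in> {a..N}"
    then have k: "1 \<le> real k" using assms by simp
    then have "0 < 4 * (real k)\<^sup>2 - 1" using one_le_power[of "real k" 2] by linarith
    then have "1 / (real k)\<^sup>2 \<le> 4 / (4 * (real k)\<^sup>2 - 1)" using k by (simp add: field_simps)
    also have "\<dots> = (- 2 / (2 * real (Suc k) - 1)) - (- 2 / (2 * real k - 1))"
      using k by (simp add: field_simps power2_eq_square)
    finally show "1 / (real k)\<^sup>2 \<le> (- 2 / (2 * real (Suc k) - 1)) - (- 2 / (2 * real k - 1))" .
  qed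
  also have "\<dots> = (- 2 / (2 * real (Suc N) - 1)) - (- 2 / (2 * real a - 1))"
    using True by (intro sum_Suc_diff) simp
  also have "\<dots> \<le> 2 / (2 * real a - 1)" by simp
  finally show ?thesis .
next
  case False
  then show ?thesis using assms by simp
qed

lemma sum_weight_defect_le:
  assumes pr: "\<And>p. p \<in> P \<Longrightarrow> prime p" and z: "2 \<le> z"
  shows "(\<Sum>n\<in>{1..N}. weight_defect P z Z n) \<le> real N / z"
proof -
  \<comment> \<open>Rounding \<open>z\<close> up loses nothing for primes and yields the integer gap
    \<open>Z \<ge> a + 1\<close> when \<open>Z\<close> is an integer exceeding some prime of
    \<open>[z, Z)\<close>.\<close>
  define a where "a = nat \<lceil>z\<rceil>"
  have a: "z \<le> real a" "2 \<le> real a" using z unfolding a_def by linarith+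
  have a_le: "a \<le> p" if "z \<le> real p" for p using that z unfolding a_def by linarith
  let ?G = "\<lambda>n. {p. p \<in> P \<and> z \<le> real p \<and> real p < Z \<and> p dvd n}"
  let ?s = "\<lambda>n. \<Sum>p=a..N. if p\<^sup>2 dvd n then 1 / 2 else (0::real)"
  let ?t = "\<lambda>n. if ?G n \<noteq> {} \<and> (\<exists>q\<in>P. real q = Z \<and> q dvd n) then 1 / 2 else (0::real)"
  have "(\<Sum>n\<in>{1..N}. weight_defect P z Z n) \<le> (\<Sum>n\<in>{1..N}. ?s n + ?t n)"
  proof (rule sum_mono)
    fix n assume n: "n \<in> {1..N}"
    \<comment> \<open>The primes are relaxed to all integers of \<open>[a, N]\<close>, since the sum
      of inverse squares already converges fast enough.\<close>
    have "?G n \<subseteq> {a..N}" using n a_le by (auto dest!: dvd_imp_le)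
    then have "(\<Sum>p\<in>?G n. if p\<^sup>2 dvd n then 1 / 2 else (0::real)) \<le> ?s n"
      by (intro sum_mono2) auto
    moreover have "weight_defect P z Z n \<le> (\<Sum>p\<in>?G n. if p\<^sup>2 dvd n then 1 / 2 else 0) + ?t n"
      using n by (intro weight_defect_bounds(3) pr) auto
    ultimately show "weight_defect P z Z n \<le> ?s n + ?t n" by linarith
  qed
  also have "\<dots> = (\<Sum>n\<in>{1..N}. ?s n) + (\<Sum>n\<in>{1..N}. ?t n)" by (rule sum.distrib)
  also have "(\<Sum>n\<in>{1..N}. ?s n) \<le> real N * (1 / (2 * real a - 1))"
  proof -
    have "(\<Sum>n\<in>{1..N}. ?s n) = (\<Sum>p=a..N. \<Sum>n\<in>{1..N}. if p\<^sup>2 dvd n then 1 / 2 else 0)"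
      by (rule sum.swap)
    also have "\<dots> = (\<Sum>p=a..N. 1 / 2 * real (card {n\<in>{1..N}. p\<^sup>2 dvd n}))"
      by (intro sum.cong refl) (subst sum.inter_filter [symmetric], auto)
    also have "\<dots> \<le> (\<Sum>p=a..N. 1 / 2 * (real N / real (p\<^sup>2)))"
      by (intro sum_mono mult_left_mono card_multiples_le) auto
    also have "\<dots> = real N / 2 * (\<Sum>p=a..N. 1 / (real p)\<^sup>2)"
      by (simp add: sum_distrib_left)
    also have "\<dots> \<le> real N / 2 * (2 / (2 * real a - 1))"
      using a by (intro mult_left_mono sum_inverse_squares_le) auto
    finally show ?thesis by simp
  qed
  \<comment> \<open>A nonzero term forces a prime \<open>p\<close> with
    \<open>a \<le> p < q = Z\<close>, so \<open>q \<ge> a + 1\<close>, and only the multiples of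
    \<open>q\<close> contribute.\<close>
  also have "(\<Sum>n\<in>{1..N}. ?t n) \<le> real N * (1 / (2 * real a + 2))"
  proof (cases "\<exists>q\<in>P. real q = Z \<and> a + 1 \<le> q")
    case True
    then obtain q where q: "q \<in> P" "real q = Z" "a + 1 \<le> q" by auto
    have "(\<Sum>n\<in>{1..N}. ?t n) \<le> (\<Sum>n\<in>{1..N}. if q dvd n then 1 / 2 else 0)"
      using q by (intro sum_mono) auto
    also have "\<dots> = 1 / 2 * real (card {n\<in>{1..N}. q dvd n})"
      by (subst sum.inter_filter [symmetric]) auto
    also have "\<dots> \<le> 1 / 2 * (real N / real q)"
      by (intro mult_left_mono card_multiples_le) auto
    also have "\<dots> = real N * (1 / (2 * real q))" by simp
    also have "\<dots> \<le> real N * (1 / (2 * real a + 2))"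
      using q by (intro mult_left_mono frac_le) auto
    finally show ?thesis .
  next
    case False
    have "?t n = 0" for n
      using False a_le by (force simp: Suc_le_eq)
    then have "(\<Sum>n\<in>{1..N}. ?t n) = 0" by (intro sum.neutral) blast
    then show ?thesis by simp
  qed
  also have "real N * (1 / (2 * real a - 1)) + real N * (1 / (2 * real a + 2))
      = real N * (1 / (2 * real a - 1) + 1 / (2 * real a + 2))" by (simp only: distrib_left)
  also have "\<dots> \<le> real N * (1 / real a)"
  proof (rule mult_left_mono)
    \<comment> \<open>After expansion this is just \<open>a \<ge> 2\<close>.\<close>
    have "real a * (4 * real a + 1) \<le> (2 * real a - 1) * (2 * real a + 2)"
      using a by (simp add: algebra_simps)
    moreover have "0 < (2 * real a - 1) * (2 * real a + 2)" using a by (intro mult_pos_pos) auto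
    ultimately have "(4 * real a + 1) / ((2 * real a - 1) * (2 * real a + 2)) \<le> 1 / real a"
      using a by (simp add: divide_le_eq le_divide_eq mult.commute)
    moreover have "1 / (2 * real a - 1) + 1 / (2 * real a + 2)
        = (4 * real a + 1) / ((2 * real a - 1) * (2 * real a + 2))"
      using a by (subst add_frac_eq) auto
    ultimately show "1 / (2 * real a - 1) + 1 / (2 * real a + 2) \<le> 1 / real a" by simp
  qed simp
  also have "\<dots> \<le> real N / z" using a z by (simp add: divide_left_mono)
  finally show ?thesis by simp
qed

section \<open>The exact identity and the final estimates\<close>

lemma cauchy_schwarz_sqrt:
  fixes f g :: "'a \<Rightarrow> real"
  assumes "(\<Sum>i\<in>I. (g i)\<^sup>2) \<le> B"
  shows "(\<Sum>i\<in>I. \<bar>f i\<bar> * \<bar>g i\<bar>) \<le> sqrt (\<Sum>i\<in>I. (f i)\<^sup>2) * sqrt B"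
proof -
  have "(\<Sum>i\<in>I. \<bar>f i\<bar> * \<bar>g i\<bar>) \<le> sqrt (\<Sum>i\<in>I. (f i)\<^sup>2) * sqrt (\<Sum>i\<in>I. (g i)\<^sup>2)"
    using L2_set_mult_ineq[of f g I] by (simp add: L2_set_def)
  also have "\<dots> \<le> sqrt (\<Sum>i\<in>I. (f i)\<^sup>2) * sqrt B"
    using assms by (intro mult_left_mono) (auto intro: sum_nonneg)
  finally show ?thesis .
qed

text \<open>Reindexing by \<open>n = m * p\<close> turns the bilinear sum into one with a
  coefficient for each \<open>n\<close>, so that it can be compared termwise with the sieve
  sums.\<close>

lemma sum_rho_pairs:
  fixes u :: "nat \<Rightarrow> complex"
  assumes pr: "\<And>p. p \<in> P \<Longrightarrow> prime p"
  shows "(\<Sum>(m, p) | 1 \<le> m \<and> p \<in> P \<and> z \<le> real p \<and> real p < Z \<and> m * p \<le> N.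
            of_real (rho P z Z m) * u (m * p))
    = (\<Sum>n\<in>{1..N}. u n * of_real (\<Sum>p | p \<in> P \<and> z \<le> real p \<and> real p < Z \<and> p dvd n. rho P z Z (n div p)))"
proof -
  let ?G = "\<lambda>n. {p. p \<in> P \<and> z \<le> real p \<and> real p < Z \<and> p dvd n}"
  have pos: "0 < p" if "p \<in> P" for p using pr[OF that] by (rule prime_gt_0_nat)
  have fin: "finite (?G n)" if "n \<in> {1..N}" for n
    by (rule finite_subset[of _ "{..n}"]) (use that in \<open>auto dest: dvd_imp_le\<close>)
  have "(\<Sum>n\<in>{1..N}. u n * of_real (\<Sum>p\<in>?G n. rho P z Z (n div p)))
      = (\<Sum>n\<in>{1..N}. \<Sum>p\<in>?G n. of_real (rho P z Z (n div p)) * u n)"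
    by (simp add: sum_distrib_left mult.commute)
  also have "\<dots> = (\<Sum>(n, p)\<in>Sigma {1..N} ?G. of_real (rho P z Z (n div p)) * u n)"
    using fin by (intro sum.Sigma) auto
  also have "\<dots> = (\<Sum>(m, p) | 1 \<le> m \<and> p \<in> P \<and> z \<le> real p \<and> real p < Z \<and> m * p \<le> N.
            of_real (rho P z Z m) * u (m * p))"
  proof (rule sum.reindex_bij_witness[where i = "\<lambda>(m, p). (m * p, p)" and j = "\<lambda>(n, p). (n div p, p)"])
    fix x assume "x \<in> Sigma {1..N} ?G"
    then obtain n p where x: "x = (n, p)" "1 \<le> n" "n \<le> N" "p \<in> ?G n" by auto
    then have "1 \<le> n div p" using pos[of p] by (auto simp: div_greater_zero_iff Suc_le_eq dest: dvd_imp_le)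
    then show "(case x of (n, p) \<Rightarrow> (n div p, p)) \<in>
        {(m, p). 1 \<le> m \<and> p \<in> P \<and> z \<le> real p \<and> real p < Z \<and> m * p \<le> N}"
      using x by auto
  qed (use pos in \<open>auto simp: Suc_le_eq\<close>)
  finally show ?thesis by simp
qed

text \<open>Surviving up to \<open>Z\<close> means surviving up to \<open>z\<close> and having no
  prime divisor from \<open>P\<close> in \<open>[z, Z)\<close>. The first condition is replaced by
  the truncated Moebius sum and the failure of the second by the \<open>rho\<close> weights; the
  last sum collects both errors.\<close>

lemma sieve_remainder_identity:
  fixes u :: "nat \<Rightarrow> complex"
  assumes pr: "\<And>p. p \<in> P \<Longrightarrow> prime p" and zZ: "z \<le> Z"
  defines "A \<equiv> {p. p \<in> P \<and> real p < z}"
  shows "(\<Sum>n | n \<in> {1..N} \<and> coprime n (prime_prod P Z). u n) =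
        (\<Sum>d | d dvd prime_prod P z \<and> real d \<le> D.
            of_int (moebius_mu d) * (\<Sum>n | n \<in> {1..N} \<and> d dvd n. u n))
        - (\<Sum>(m, p) | 1 \<le> m \<and> p \<in> P \<and> z \<le> real p \<and> real p < Z \<and> m * p \<le> N.
            of_real (rho P z Z m) * u (m * p))
        + (\<Sum>n\<in>{1..N}. u n * of_real (((if {p\<in>A. p dvd n} = {} then 1 else 0) -
            (\<Sum>d | d dvd \<Prod>A \<and> real d \<le> D \<and> d dvd n. real_of_int (moebius_mu d)))
            - weight_defect P z Z n))"
proof -
  let ?M = "\<lambda>n. \<Sum>d | d dvd \<Prod>A \<and> real d \<le> D \<and> d dvd n. real_of_int (moebius_mu d)"
  let ?R = "\<lambda>n. \<Sum>p | p \<in> P \<and> z \<le> real p \<and> real p < Z \<and> p dvd n. rho P z Z (n div p)"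
  let ?e = "\<lambda>n. ((if {p\<in>A. p dvd n} = {} then 1 else 0) - ?M n) - weight_defect P z Z n"
  have finA: "finite A"
    unfolding A_def by (rule finite_nat_real_less)
  have "\<Prod>A \<noteq> 0" using finA pr[of 0] by (auto simp: A_def)
  then have finD: "finite {d. d dvd \<Prod>A \<and> real d \<le> D}" by auto
  have A: "prime_prod P z = \<Prod>A" by (simp add: prime_prod_def A_def)
  have main: "(\<Sum>d | d dvd \<Prod>A \<and> real d \<le> D.
            of_int (moebius_mu d) * (\<Sum>n | n \<in> {1..N} \<and> d dvd n. u n))
      = (\<Sum>n\<in>{1..N}. u n * of_real (?M n))"
  proof -
    have "(\<Sum>d | d dvd \<Prod>A \<and> real d \<le> D. of_int (moebius_mu d) * (\<Sum>n | n \<in> {1..N} \<and> d dvd n. u n))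
      = (\<Sum>d | d dvd \<Prod>A \<and> real d \<le> D. \<Sum>n\<in>{1..N}. if d dvd n then of_int (moebius_mu d) * u n else 0)"
      by (intro sum.cong refl) (subst sum.inter_filter [symmetric], auto simp: sum_distrib_left)
    also have "\<dots> = (\<Sum>n\<in>{1..N}. \<Sum>d | d dvd \<Prod>A \<and> real d \<le> D. if d dvd n then of_int (moebius_mu d) * u n else 0)"
      by (rule sum.swap)
    also have "\<dots> = (\<Sum>n\<in>{1..N}. u n * of_real (?M n))"
      using finD by (intro sum.cong refl, subst sum.inter_filter [symmetric])
        (auto simp: sum_distrib_left mult.commute conj_assoc)
    finally show ?thesis .
  qed
  have ind: "of_real (if coprime n (prime_prod P Z) then 1 else 0) = of_real (?M n) - of_real (?R n) + complex_of_real (?e n)" for n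
  proof -
    let ?g = "\<exists>p\<in>P. z \<le> real p \<and> real p < Z \<and> p dvd n"
    have cop_z: "coprime n (prime_prod P z) \<longleftrightarrow> {p\<in>A. p dvd n} = {}"
      using coprime_prime_prod_iff[OF pr, where n = n and y = z] by (auto simp: A_def)
    have cop_Z: "coprime n (prime_prod P Z) \<longleftrightarrow> coprime n (prime_prod P z) \<and> \<not> ?g"
      using coprime_prime_prod_iff[OF pr, where n = n and y = z] coprime_prime_prod_iff[OF pr, where n = n and y = Z] zZ by force
    \<comment> \<open>Only the indicator of \<open>a\<close> minus that of \<open>a \<and> g\<close>
      matters; \<open>M\<close> and \<open>R\<close> cancel.\<close>
    have "(if a \<and> \<not> g then 1 else 0) = M - R + (((if a then 1 else 0) - M) - ((if a \<and> g then 1 else 0) - R))"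
      for a g and M R :: real by simp
    then have "(if coprime n (prime_prod P Z) then 1 else 0) = ?M n - ?R n + ?e n"
      unfolding weight_defect_def cop_Z cop_z .
    from arg_cong[OF this, of complex_of_real] show ?thesis by (simp only: of_real_add of_real_diff)
  qed
  have "(\<Sum>n | n \<in> {1..N} \<and> coprime n (prime_prod P Z). u n)
      = (\<Sum>n\<in>{1..N}. u n * of_real (if coprime n (prime_prod P Z) then 1 else 0))"
  proof -
    have "(\<Sum>n | n \<in> {1..N} \<and> coprime n (prime_prod P Z). u n)
      = (\<Sum>n\<in>{1..N}. if coprime n (prime_prod P Z) then u n else 0)"
      by (subst sum.inter_filter [symmetric]) auto
    then show ?thesis by (simp add: if_distrib cong: if_cong)
  qed
  also have "\<dots> = (\<Sum>n\<in>{1..N}. u n * of_real (?M n)) - (\<Sum>n\<in>{1..N}. u n * of_real (?R n))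
       + (\<Sum>n\<in>{1..N}. u n * of_real (?e n))"
    unfolding ind by (simp only: distrib_left right_diff_distrib sum.distrib sum_subtractf)
  also have "(\<Sum>n\<in>{1..N}. u n * of_real (?R n))
      = (\<Sum>(m, p) | 1 \<le> m \<and> p \<in> P \<and> z \<le> real p \<and> real p < Z \<and> m * p \<le> N.
            of_real (rho P z Z m) * u (m * p))"
    by (rule sum_rho_pairs[OF pr, symmetric])
  finally show ?thesis unfolding A main .
qed

lemma eq_add_unit_disc_factor:
  fixes x s t :: complex
  assumes "s = t + x" "norm x \<le> E"
  shows "\<exists>\<theta>::complex. norm \<theta> \<le> 1 \<and> s = t + \<theta> * of_real E"
proof (cases "E = 0")
  case False
  then have "0 < E" using assms norm_ge_zero[of x] by linarith
  then show ?thesis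
    using assms by (intro exI[of _ "x / of_real E"]) (auto simp: norm_divide divide_le_eq)
qed (use assms in \<open>auto intro: exI[of _ 0]\<close>)

theorem theorem1p1:
  fixes P :: "nat set" and \<kappa> :: real
  assumes "infinite P" and "\<And>p. p \<in> P \<Longrightarrow> prime p"
    and "0 < \<kappa>" and "\<kappa> \<le> 1" and "has_log_density P \<kappa>"
  shows "\<exists>N0::nat. \<forall>N\<ge>N0. \<forall>(z::real) (D::real) (Z::real) (u :: nat \<Rightarrow> complex).
    2 \<le> z \<and> z \<le> D \<and> D \<le> sqrt (real N) \<and> z \<le> Z \<longrightarrow>
    (\<exists>\<theta>::complex. norm \<theta> \<le> 1 \<and>
      (\<Sum>n | n \<in> {1..N} \<and> coprime n (prime_prod P Z). u n) =
        (\<Sum>d | d dvd prime_prod P z \<and> real d \<le> D.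
            of_int (moebius_mu d) * (\<Sum>n | n \<in> {1..N} \<and> d dvd n. u n))
        - (\<Sum>(m, p) | 1 \<le> m \<and> p \<in> P \<and> z \<le> real p \<and> real p < Z \<and> m * p \<le> N.
            of_real (rho P z Z m) * u (m * p))
        + \<theta> * of_real
            (sqrt (real N * (\<Sum>n\<in>{1..N}. (norm (u n))\<^sup>2)) *
              (1 / sqrt z + exp (- ln D / ln z) * ln (3 * z) ^ 31))) \<and>
    ((\<forall>n\<in>{1..N}. norm (u n) \<le> 1) \<longrightarrow>
      (\<exists>\<theta>::complex. norm \<theta> \<le> 1 \<and>
      (\<Sum>n | n \<in> {1..N} \<and> coprime n (prime_prod P Z). u n) =
        (\<Sum>d | d dvd prime_prod P z \<and> real d \<le> D.
            of_int (moebius_mu d) * (\<Sum>n | n \<in> {1..N} \<and> d dvd n. u n))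
        - (\<Sum>(m, p) | 1 \<le> m \<and> p \<in> P \<and> z \<le> real p \<and> real p < Z \<and> m * p \<le> N.
            of_real (rho P z Z m) * u (m * p))
        + \<theta> * of_real
            (real N / z +
              sqrt (real N * (\<Sum>n\<in>{1..N}. (norm (u n))\<^sup>2)) *
                (exp (- ln D / ln z) * ln (3 * z) ^ 31))))"
proof (intro exI[of _ 0] allI impI, goal_cases)
  case (1 N z D Z u)
  then have z: "2 \<le> z" and D: "0 < D" and zZ: "z \<le> Z" by auto
  note pr = assms(2)
  let ?A = "{p. p \<in> P \<and> real p < z}"
  let ?e = "\<lambda>n. (if {p\<in>?A. p dvd n} = {} then 1 else 0) -
      (\<Sum>d | d dvd \<Prod>?A \<and> real d \<le> D \<and> d dvd n. real_of_int (moebius_mu d))"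
  let ?c = "weight_defect P z Z"
  let ?U = "\<Sum>n\<in>{1..N}. (norm (u n))\<^sup>2"
  let ?t = "exp (- ln D / ln z) * ln (3 * z) ^ 31"
  define X where "X = (\<Sum>n\<in>{1..N}. u n * of_real (?e n - ?c n))"
  have t: "0 \<le> ?t" using z by simp
  have c: "0 \<le> ?c n" "?c n \<le> 1" if "n \<in> {1..N}" for n
    using weight_defect_bounds(1,2)[OF pr, where n = n] that by auto
  have sum_e: "(\<Sum>n\<in>{1..N}. (?e n)\<^sup>2) \<le> real N * ?t\<^sup>2"
    by (rule sum_truncated_moebius_error_squared_le) (use pr z D in auto)
  have sum_c: "(\<Sum>n\<in>{1..N}. ?c n) \<le> real N / z" by (rule sum_weight_defect_le[OF pr z])
  have "norm X \<le> (\<Sum>n\<in>{1..N}. norm (u n) * \<bar>?e n\<bar> + norm (u n) * \<bar>?c n\<bar>)"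
    unfolding X_def
  proof (rule sum_norm_le)
    fix n
    have "norm (u n * of_real (?e n - ?c n)) = norm (u n) * \<bar>?e n - ?c n\<bar>"
      by (simp only: norm_mult norm_of_real)
    also have "\<dots> \<le> norm (u n) * (\<bar>?e n\<bar> + \<bar>?c n\<bar>)" by (intro mult_left_mono) auto
    finally show "norm (u n * of_real (?e n - ?c n)) \<le> norm (u n) * \<bar>?e n\<bar> + norm (u n) * \<bar>?c n\<bar>"
      by (simp only: distrib_left)
  qed
  also have "\<dots> = (\<Sum>n\<in>{1..N}. norm (u n) * \<bar>?e n\<bar>) + (\<Sum>n\<in>{1..N}. norm (u n) * \<bar>?c n\<bar>)"
    by (rule sum.distrib)
  also have "(\<Sum>n\<in>{1..N}. norm (u n) * \<bar>?e n\<bar>) \<le> sqrt ?U * sqrt (real N * ?t\<^sup>2)"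
    using cauchy_schwarz_sqrt[of ?e "{1..N}" "real N * ?t\<^sup>2" "\<lambda>n. norm (u n)", OF sum_e]
    by (simp only: abs_norm_cancel)
  also have "sqrt ?U * sqrt (real N * ?t\<^sup>2) = sqrt (real N * ?U) * ?t"
    using t by (simp only: real_sqrt_mult real_sqrt_abs abs_of_nonneg mult_ac)
  finally have X: "norm X \<le> sqrt (real N * ?U) * ?t + (\<Sum>n\<in>{1..N}. norm (u n) * \<bar>?c n\<bar>)"
    by (simp only: add_le_cancel_right)
  \<comment> \<open>The defect lies in \<open>[0, 1]\<close>, so its mean square is controlled by
    its mean. Cauchy-Schwarz then takes the square root of \<open>N / z\<close>, hence the term
    \<open>1 / sqrt z\<close>.\<close>
  have "(\<Sum>n\<in>{1..N}. (?c n)\<^sup>2) \<le> (\<Sum>n\<in>{1..N}. ?c n)"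
    using c by (intro sum_mono) (simp add: power2_eq_square mult_left_le)
  then have "(\<Sum>n\<in>{1..N}. (?c n)\<^sup>2) \<le> real N / z" using sum_c by linarith
  then have "(\<Sum>n\<in>{1..N}. norm (u n) * \<bar>?c n\<bar>) \<le> sqrt ?U * sqrt (real N / z)"
    using cauchy_schwarz_sqrt[of ?c "{1..N}" "real N / z" "\<lambda>n. norm (u n)"] by simp
  also have "\<dots> = sqrt (real N * ?U) * (1 / sqrt z)"
    by (simp add: real_sqrt_mult real_sqrt_divide)
  finally have E1: "norm X \<le> sqrt (real N * ?U) * (1 / sqrt z + ?t)"
    using X unfolding distrib_left by linarith
  have E2: "norm X \<le> real N / z + sqrt (real N * ?U) * ?t" if u: "\<forall>n\<in>{1..N}. norm (u n) \<le> 1"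
  proof -
    \<comment> \<open>For bounded \<open>u\<close> the mean of the defect is used directly, which
      keeps the full saving \<open>1 / z\<close>.\<close>
    have "(\<Sum>n\<in>{1..N}. norm (u n) * \<bar>?c n\<bar>) \<le> (\<Sum>n\<in>{1..N}. ?c n)"
      using u c by (intro sum_mono) (simp add: mult_left_le_one_le)
    then show ?thesis using X sum_c by linarith
  qed
  note factor = eq_add_unit_disc_factor[OF sieve_remainder_identity[OF pr zZ]]
  show ?case
    by (intro conjI impI factor E1[unfolded X_def] E2[unfolded X_def])
qed

end
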